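(* Let $(\Gamma,f,m)$ be a Dyer graph with $\Gamma$ finite. Then the Dyer group $D(\Gamma,f,m)$ is (isomorphic to) a finite index subgroup of some Coxeter group.
   Context: Dyer graph: a triple $(\Gamma,f,m)$ where $\Gamma$ is a simplicial graph with vertex set $V$ and edge set $E$, and $f:V\to\mathbb{N}_{\ge 2}\cup\{\infty\}$, $m:E\to\mathbb{N}_{\ge 2}$ are maps such that $m(e)=2$ for every edge $e=\{v,w\}$ with $f(v)\ge 3$ (this includes $f(v)=\infty$). For $k\in\mathbb{N}$ write $[a,b]_k=\underbrace{aba\cdots}_{k}$ (alternating word of length $k$ starting with $a$). The Dyer group $D(\Gamma,f,m)$ is $$\langle x_v,\ v\in V\mid x_v^{f(v)}=1 \text{ if } f(v)\ne\infty,\ [x_v,x_u]_{m(e)}=[x_u,x_v]_{m(e)} \text{ for all } e=\{u,v\}\in E\rangle .$$ *)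

theory Defs
  imports "HOL-Algebra.Coset" "HOL-Library.Extended_Nat"
begin

subsection \<open>Groups given by generators and relations\<close>

text \<open>A word is a list of signed letters: \<open>(x, True)\<close> stands for the generator \<open>x\<close> and
  \<open>(x, False)\<close> for its formal inverse.\<close>

type_synonym 'a word = "('a \<times> bool) list"

definition words :: "'a set \<Rightarrow> 'a word set"
  where "words X = lists (X \<times> UNIV)"

text \<open>A pair \<open>(r, s) \<in> R\<close> is the defining relation \<open>r = s\<close>. The following is the least congruence
  on the words over \<open>X\<close> that contains free cancellation and the relations \<open>R\<close>.\<close>

inductive pres_eq :: "'a set \<Rightarrow> ('a word \<times> 'a word) set \<Rightarrow> 'a word \<Rightarrow> 'a word \<Rightarrow> bool"
  for X :: "'a set" and R :: "('a word \<times> 'a word) set" where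
  refl: "w \<in> words X \<Longrightarrow> pres_eq X R w w"
| sym: "pres_eq X R v w \<Longrightarrow> pres_eq X R w v"
| trans: "pres_eq X R u v \<Longrightarrow> pres_eq X R v w \<Longrightarrow> pres_eq X R u w"
| cancel: "u \<in> words X \<Longrightarrow> v \<in> words X \<Longrightarrow> x \<in> X \<Longrightarrow>
    pres_eq X R (u @ [(x, b), (x, \<not> b)] @ v) (u @ v)"
| rel: "(r, s) \<in> R \<Longrightarrow> u @ r @ v \<in> words X \<Longrightarrow> u @ s @ v \<in> words X \<Longrightarrow>
    pres_eq X R (u @ r @ v) (u @ s @ v)"

definition pres_class :: "'a set \<Rightarrow> ('a word \<times> 'a word) set \<Rightarrow> 'a word \<Rightarrow> 'a word set"
  where "pres_class X R w = {w'. pres_eq X R w w'}"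

definition presented_group :: "'a set \<Rightarrow> ('a word \<times> 'a word) set \<Rightarrow> 'a word set monoid"
  where "presented_group X R =
    \<lparr>carrier = pres_class X R ` words X,
     mult = (\<lambda>A B. \<Union>u\<in>A. \<Union>v\<in>B. pres_class X R (u @ v)),
     one = pres_class X R []\<rparr>"

lemma words_append [simp]: "u @ v \<in> words X \<longleftrightarrow> u \<in> words X \<and> v \<in> words X"
  by (auto simp: words_def)

lemma pres_eq_words: "pres_eq X R v w \<Longrightarrow> v \<in> words X \<and> w \<in> words X"
  by (induction rule: pres_eq.induct) (auto simp: words_def)

lemma pres_eq_append_left:
  assumes "pres_eq X R v w" "u \<in> words X"
  shows "pres_eq X R (u @ v) (u @ w)"
  using assms
proof (induction rule: pres_eq.induct)
  case (cancel u' v x b)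
  then show ?case using pres_eq.cancel[of "u @ u'" X v x R b] by simp
next
  case (rel r s u' v)
  then show ?case using pres_eq.rel[of r s R "u @ u'" v X] by simp
next
  case (trans u' v w)
  then show ?case using pres_eq.trans by blast
next
  case (sym v w)
  then show ?case using pres_eq.sym by blast
next
  case (refl w)
  then show ?case by (intro pres_eq.refl) simp
qed

lemma pres_eq_append_right:
  assumes "pres_eq X R v w" "u \<in> words X"
  shows "pres_eq X R (v @ u) (w @ u)"
  using assms
proof (induction rule: pres_eq.induct)
  case (cancel u' v x b)
  then show ?case using pres_eq.cancel[of u' X "v @ u" x R b] by simp
next
  case (rel r s u' v)
  then show ?case using pres_eq.rel[of r s R u' "v @ u" X] by simp
next
  case (trans u' v w)
  then show ?case using pres_eq.trans by blast
next
  case (sym v w)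
  then show ?case using pres_eq.sym by blast
next
  case (refl w)
  then show ?case by (intro pres_eq.refl) simp
qed

lemma pres_eq_append:
  "pres_eq X R u u' \<Longrightarrow> pres_eq X R v v' \<Longrightarrow> pres_eq X R (u @ v) (u' @ v')"
  using pres_eq.trans[OF pres_eq_append_right[of X R u u' v] pres_eq_append_left[of X R v v' u']]
    pres_eq_words[of X R u u'] pres_eq_words[of X R v v'] by blast

lemma pres_class_eq_iff:
  assumes "v \<in> words X"
  shows "pres_class X R v = pres_class X R w \<longleftrightarrow> pres_eq X R v w"
proof
  assume "pres_class X R v = pres_class X R w"
  moreover have "v \<in> pres_class X R v"
    using assms by (simp add: pres_class_def pres_eq.refl)
  ultimately have "pres_eq X R w v" by (simp add: pres_class_def)
  then show "pres_eq X R v w" by (rule pres_eq.sym)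
next
  assume vw: "pres_eq X R v w"
  have "pres_eq X R v x \<longleftrightarrow> pres_eq X R w x" for x
    using pres_eq.trans[OF vw, of x] pres_eq.trans[OF pres_eq.sym[OF vw], of x] by blast
  then show "pres_class X R v = pres_class X R w" by (simp add: pres_class_def)
qed

lemma presented_group_mult [simp]:
  assumes "u \<in> words X" "v \<in> words X"
  shows "pres_class X R u \<otimes>\<^bsub>presented_group X R\<^esub> pres_class X R v = pres_class X R (u @ v)"
proof -
  have "pres_class X R (u' @ v') = pres_class X R (u @ v)"
    if "u' \<in> pres_class X R u" "v' \<in> pres_class X R v" for u' v'
  proof -
    have "pres_eq X R (u @ v) (u' @ v')"
      using that by (intro pres_eq_append) (simp_all add: pres_class_def)
    then show ?thesis using assms pres_class_eq_iff[of "u @ v" X R "u' @ v'"] by simp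
  qed
  moreover have "u \<in> pres_class X R u" "v \<in> pres_class X R v"
    using assms by (simp_all add: pres_class_def pres_eq.refl)
  ultimately have "(\<Union>u'\<in>pres_class X R u. \<Union>v'\<in>pres_class X R v. pres_class X R (u' @ v'))
      = pres_class X R (u @ v)"
    by blast
  then show ?thesis by (simp add: presented_group_def)
qed

lemma pres_eq_inverse:
  "w \<in> words X \<Longrightarrow> pres_eq X R (rev (map (\<lambda>(x, b). (x, \<not> b)) w) @ w) []"
proof (induction w)
  case Nil
  then show ?case by (simp add: pres_eq.refl)
next
  case (Cons a w)
  obtain x b where a: "a = (x, b)" by force
  have *: "x \<in> X" "w \<in> words X" "rev (map (\<lambda>(x, b). (x, \<not> b)) w) \<in> words X"
    using Cons.prems by (auto simp: a words_def)
  have "pres_eq X R (rev (map (\<lambda>(x, b). (x, \<not> b)) (a # w)) @ a # w)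
      (rev (map (\<lambda>(x, b). (x, \<not> b)) w) @ w)"
    using pres_eq.cancel[OF *(3,2,1), of R "\<not> b"] by (simp add: a)
  then show ?case
    using Cons.IH[OF *(2)] by (rule pres_eq.trans)
qed

lemma group_presented_group: "group (presented_group X R)"
proof (rule groupI)
  show "\<one>\<^bsub>presented_group X R\<^esub> \<in> carrier (presented_group X R)"
    by (auto simp: presented_group_def words_def)
next
  fix A B assume "A \<in> carrier (presented_group X R)" "B \<in> carrier (presented_group X R)"
  then obtain u v where "A = pres_class X R u" "B = pres_class X R v" "u \<in> words X" "v \<in> words X"
    by (auto simp: presented_group_def)
  then show "A \<otimes>\<^bsub>presented_group X R\<^esub> B \<in> carrier (presented_group X R)"
    by simp (simp add: presented_group_def)
next
  fix A B C
  assume "A \<in> carrier (presented_group X R)" "B \<in> carrier (presented_group X R)"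
    "C \<in> carrier (presented_group X R)"
  then obtain u v w where "A = pres_class X R u" "B = pres_class X R v" "C = pres_class X R w"
    "u \<in> words X" "v \<in> words X" "w \<in> words X"
    by (auto simp: presented_group_def)
  then show "A \<otimes>\<^bsub>presented_group X R\<^esub> B \<otimes>\<^bsub>presented_group X R\<^esub> C =
      A \<otimes>\<^bsub>presented_group X R\<^esub> (B \<otimes>\<^bsub>presented_group X R\<^esub> C)"
    by simp
next
  fix A assume "A \<in> carrier (presented_group X R)"
  then obtain u where u: "A = pres_class X R u" "u \<in> words X"
    by (auto simp: presented_group_def)
  have one: "\<one>\<^bsub>presented_group X R\<^esub> = pres_class X R []"
    by (simp add: presented_group_def)
  have nil: "[] \<in> words X" by (simp add: words_def)
  show "\<one>\<^bsub>presented_group X R\<^esub> \<otimes>\<^bsub>presented_group X R\<^esub> A = A"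
    using u nil by (simp add: one)
  let ?i = "rev (map (\<lambda>(x, b). (x, \<not> b)) u)"
  have i: "?i \<in> words X" using u(2) by (auto simp: words_def)
  have "pres_class X R ?i \<otimes>\<^bsub>presented_group X R\<^esub> A = \<one>\<^bsub>presented_group X R\<^esub>"
    using u i pres_eq_inverse[OF u(2)] by (simp add: one pres_class_eq_iff)
  moreover have "pres_class X R ?i \<in> carrier (presented_group X R)"
    using i by (simp add: presented_group_def)
  ultimately show "\<exists>B\<in>carrier (presented_group X R).
      B \<otimes>\<^bsub>presented_group X R\<^esub> A = \<one>\<^bsub>presented_group X R\<^esub>"
    by blast
qed

subsection \<open>Dyer groups\<close>

text \<open>Edges are two-element sets of vertices. The values of \<open>f\<close> outside \<open>V\<close> and of \<open>m\<close> outside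
  \<open>E\<close> are irrelevant.\<close>

locale dyer_graph =
  fixes V :: "'v set" and E :: "'v set set" and f :: "'v \<Rightarrow> enat" and m :: "'v set \<Rightarrow> nat"
  assumes edges: "e \<in> E \<Longrightarrow> e \<subseteq> V \<and> card e = 2"
    and f_ge_2: "v \<in> V \<Longrightarrow> f v \<ge> 2"
    and m_ge_2: "e \<in> E \<Longrightarrow> m e \<ge> 2"
    and m_eq_2: "e \<in> E \<Longrightarrow> v \<in> e \<Longrightarrow> f v \<ge> 3 \<Longrightarrow> m e = 2"

text \<open>The alternating word \<open>aba\<dots>\<close> of length \<open>k\<close>, starting with \<open>a\<close>.\<close>

fun alternating :: "'a \<Rightarrow> 'a \<Rightarrow> nat \<Rightarrow> 'a word" where
  "alternating a b 0 = []"
| "alternating a b (Suc k) = (a, True) # alternating b a k"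

definition dyer_relations ::
    "'v set \<Rightarrow> 'v set set \<Rightarrow> ('v \<Rightarrow> enat) \<Rightarrow> ('v set \<Rightarrow> nat) \<Rightarrow> ('v word \<times> 'v word) set"
  where "dyer_relations V E f m =
    {(replicate n (v, True), []) | v n. v \<in> V \<and> f v = enat n} \<union>
    {(alternating v u (m {u, v}), alternating u v (m {u, v})) | u v. {u, v} \<in> E}"

definition dyer_group ::
    "'v set \<Rightarrow> 'v set set \<Rightarrow> ('v \<Rightarrow> enat) \<Rightarrow> ('v set \<Rightarrow> nat) \<Rightarrow> 'v word set monoid"
  where "dyer_group V E f m = presented_group V (dyer_relations V E f m)"

subsection \<open>Coxeter groups\<close>

locale coxeter_matrix =
  fixes S :: "'s set" and M :: "'s \<Rightarrow> 's \<Rightarrow> enat"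
  assumes diag: "s \<in> S \<Longrightarrow> M s s = 1"
    and off_diag: "s \<in> S \<Longrightarrow> t \<in> S \<Longrightarrow> s \<noteq> t \<Longrightarrow> M s t \<ge> 2"
    and symmetric: "s \<in> S \<Longrightarrow> t \<in> S \<Longrightarrow> M s t = M t s"

definition coxeter_relations :: "'s set \<Rightarrow> ('s \<Rightarrow> 's \<Rightarrow> enat) \<Rightarrow> ('s word \<times> 's word) set"
  where "coxeter_relations S M =
    {(concat (replicate n [(s, True), (t, True)]), []) | s t n. s \<in> S \<and> t \<in> S \<and> M s t = enat n}"

definition coxeter_group :: "'s set \<Rightarrow> ('s \<Rightarrow> 's \<Rightarrow> enat) \<Rightarrow> 's word set monoid"
  where "coxeter_group S M = presented_group S (coxeter_relations S M)"

end

theory Submission imports Defs "HOL-Algebra.Bij" begin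

text \<open>The Dyer group \<open>D\<close> is the kernel of a retraction of a Coxeter group \<open>W\<close>, namely the semidirect
  product of \<open>D\<close> with the elementary abelian 2-group on involutions \<open>y\<^sub>v\<close>, where \<open>y\<^sub>v\<close> inverts \<open>x\<^sub>v\<close> and
  fixes all other generators. As Coxeter generators of \<open>W\<close> take all \<open>y\<^sub>v\<close> together with \<open>s\<^sub>v = x\<^sub>v\<close> if
  \<open>f v = 2\<close> and \<open>s\<^sub>v = x\<^sub>v y\<^sub>v\<close> otherwise. Instead of forming the semidirect product, define
  \<open>W\<close> by its Coxeter matrix. The map \<open>D \<rightarrow> W\<close> is injective because \<open>W\<close> acts on the set \<open>D\<close>, with \<open>y\<^sub>v\<close>
  acting as the automorphism above and \<open>x\<^sub>v\<close> as left multiplication. Its image \<open>H\<close> is normalised by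
  the \<open>y\<^sub>v\<close>, so \<open>W = H Y\<close> for the finite group \<open>Y\<close> generated by them.\<close>

subsection \<open>The universal property of a presented group\<close>

definition word_value :: "('a, 'b) monoid_scheme \<Rightarrow> ('x \<Rightarrow> 'a) \<Rightarrow> 'x word \<Rightarrow> 'a"
  where "word_value G g w =
    foldr (\<lambda>(x, b) a. (if b then g x else inv\<^bsub>G\<^esub> g x) \<otimes>\<^bsub>G\<^esub> a) w \<one>\<^bsub>G\<^esub>"

text \<open>This is the hypothesis of von Dyck's theorem: such a \<open>g\<close> extends to a
  homomorphism out of \<open>presented_group X R\<close>. The maps \<sigma>, \<phi> and \<rho> below
  are all obtained by verifying it.\<close>

definition realizes ::
    "('a, 'b) monoid_scheme \<Rightarrow> ('x \<Rightarrow> 'a) \<Rightarrow> 'x set \<Rightarrow> ('x word \<times> 'x word) set \<Rightarrow> bool"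
  where "realizes G g X R \<longleftrightarrow>
    g \<in> X \<rightarrow> carrier G \<and> (\<forall>(r, s) \<in> R. word_value G g r = word_value G g s)"

definition gen :: "'x set \<Rightarrow> ('x word \<times> 'x word) set \<Rightarrow> 'x \<Rightarrow> 'x word set"
  where "gen X R x = pres_class X R [(x, True)]"

lemma word_value_Nil [simp]: "word_value G g [] = \<one>\<^bsub>G\<^esub>"
  by (simp add: word_value_def)

lemma word_value_Cons [simp]:
  "word_value G g ((x, b) # w) = (if b then g x else inv\<^bsub>G\<^esub> g x) \<otimes>\<^bsub>G\<^esub> word_value G g w"
  by (simp add: word_value_def)

lemma words_Nil [simp]: "[] \<in> words X"
  by (simp add: words_def)

lemma words_Cons [simp]: "(x, b) # w \<in> words X \<longleftrightarrow> x \<in> X \<and> w \<in> words X"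
  by (auto simp: words_def)

context group
begin

lemma word_value_closed [simp]:
  assumes "g \<in> X \<rightarrow> carrier G" "w \<in> words X"
  shows "word_value G g w \<in> carrier G"
  using assms(2)
proof (induction w)
  case (Cons a w)
  then show ?case using assms(1) by (cases a) (auto simp: Pi_iff)
qed simp

lemma word_value_append:
  assumes "g \<in> X \<rightarrow> carrier G" "u \<in> words X" "v \<in> words X"
  shows "word_value G g (u @ v) = word_value G g u \<otimes> word_value G g v"
  using assms(2)
proof (induction u)
  case Nil
  then show ?case using assms by simp
next
  case (Cons a u)
  obtain x b where "a = (x, b)" by force
  with Cons assms(1,3) show ?case
    by (auto simp: Pi_iff m_assoc word_value_closed[OF assms(1)])
qed

lemma word_value_pres_eq:
  assumes "realizes G g X R" "pres_eq X R v w"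
  shows "word_value G g v = word_value G g w"
  using assms(2)
proof (induction rule: pres_eq.induct)
  have g: "g \<in> X \<rightarrow> carrier G" using assms(1) by (simp add: realizes_def)
  {
    case (cancel u v x b)
    have "word_value G g ([(x, b), (x, \<not> b)] @ v) = word_value G g v"
      using cancel g by (auto simp: Pi_iff m_assoc[symmetric] word_value_closed[OF g])
    then show ?case
      using cancel by (simp add: word_value_append[OF g] del: append_Cons)
  next
    case (rel r s u v)
    then show ?case
      using assms(1) by (auto simp: word_value_append[OF g] realizes_def)
  }
qed auto

text \<open>Evaluating a representative picked by \<open>SOME\<close> gives the map; by
  \<open>word_value_pres_eq\<close> the choice does not affect the value.\<close>

lemma realizes_imp_hom:
  assumes "realizes G g X R"
  shows "\<exists>h \<in> hom (presented_group X R) G. \<forall>x \<in> X. h (gen X R x) = g x"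
proof
  let ?h = "\<lambda>A. word_value G g (SOME w. w \<in> A)"
  have g: "g \<in> X \<rightarrow> carrier G" using assms by (simp add: realizes_def)
  have h: "?h (pres_class X R w) = word_value G g w" if "w \<in> words X" for w
  proof -
    have "w \<in> pres_class X R w" using that by (simp add: pres_class_def pres_eq.refl)
    then have "(SOME w'. w' \<in> pres_class X R w) \<in> pres_class X R w" by (rule someI)
    then show ?thesis using word_value_pres_eq[OF assms] by (simp add: pres_class_def)
  qed
  show "?h \<in> hom (presented_group X R) G"
  proof (rule homI)
    fix A assume "A \<in> carrier (presented_group X R)"
    then show "?h A \<in> carrier G"
      using h g by (auto simp: presented_group_def)
  next
    fix A B assume "A \<in> carrier (presented_group X R)" "B \<in> carrier (presented_group X R)"
    then obtain u v where "A = pres_class X R u" "B = pres_class X R v" "u \<in> words X" "v \<in> words X"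
      by (auto simp: presented_group_def)
    then show "?h (A \<otimes>\<^bsub>presented_group X R\<^esub> B) = ?h A \<otimes> ?h B"
      using h by (simp add: word_value_append[OF g])
  qed
  show "\<forall>x \<in> X. ?h (gen X R x) = g x"
    using h g by (auto simp: gen_def Pi_iff)
qed

end

lemma one_presented_group: "\<one>\<^bsub>presented_group X R\<^esub> = pres_class X R []"
  by (simp add: presented_group_def)

lemma gen_closed [simp]: "x \<in> X \<Longrightarrow> gen X R x \<in> carrier (presented_group X R)"
  by (auto simp: gen_def presented_group_def)

lemma inv_gen:
  assumes "x \<in> X"
  shows "inv\<^bsub>presented_group X R\<^esub> gen X R x = pres_class X R [(x, False)]"
proof -
  interpret group "presented_group X R" by (rule group_presented_group)
  have "pres_class X R [(x, False)] \<in> carrier (presented_group X R)"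
    using assms by (auto simp: presented_group_def)
  moreover have "pres_class X R [(x, False)] \<otimes>\<^bsub>presented_group X R\<^esub> gen X R x
      = \<one>\<^bsub>presented_group X R\<^esub>"
    using assms pres_eq.cancel[of "[]" X "[]" x R False]
    by (simp add: gen_def one_presented_group pres_class_eq_iff)
  ultimately show ?thesis
    using assms by (intro inv_equality) simp_all
qed

lemma word_value_gen:
  assumes "w \<in> words X"
  shows "word_value (presented_group X R) (gen X R) w = pres_class X R w"
  using assms
proof (induction w)
  case Nil
  then show ?case by (simp add: one_presented_group)
next
  case (Cons a w)
  obtain x b where a: "a = (x, b)" by force
  have "(if b then gen X R x else inv\<^bsub>presented_group X R\<^esub> gen X R x) = pres_class X R [(x, b)]"
    using Cons.prems by (simp add: a inv_gen) (simp add: gen_def)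
  then show ?case using Cons by (simp add: a)
qed

lemma realizes_gen:
  assumes "R \<subseteq> words X \<times> words X"
  shows "realizes (presented_group X R) (gen X R) X R"
proof -
  have "pres_class X R r = pres_class X R s" if "(r, s) \<in> R" for r s
  proof -
    have "r \<in> words X" "s \<in> words X" using that assms by auto
    then show ?thesis
      using that pres_eq.rel[of r s R "[]" "[]" X] by (simp add: pres_class_eq_iff)
  qed
  then show ?thesis
    using assms by (auto simp: realizes_def word_value_gen)
qed

text \<open>Every element is the value of a word, and induction on the word strips its letters from
  the left. The two signs of a letter account for the two step cases.\<close>

lemma presented_group_induct [consumes 1, case_names one gen inv_gen]:
  assumes "A \<in> carrier (presented_group X R)"
    and "P \<one>\<^bsub>presented_group X R\<^esub>"
    and "\<And>x A. x \<in> X \<Longrightarrow> A \<in> carrier (presented_group X R) \<Longrightarrow> P A \<Longrightarrow>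
      P (gen X R x \<otimes>\<^bsub>presented_group X R\<^esub> A)"
    and "\<And>x A. x \<in> X \<Longrightarrow> A \<in> carrier (presented_group X R) \<Longrightarrow> P A \<Longrightarrow>
      P (inv\<^bsub>presented_group X R\<^esub> gen X R x \<otimes>\<^bsub>presented_group X R\<^esub> A)"
  shows "P A"
proof -
  interpret group "presented_group X R" by (rule group_presented_group)
  obtain w where "w \<in> words X" "A = pres_class X R w"
    using assms(1) by (auto simp: presented_group_def)
  have "P (word_value (presented_group X R) (gen X R) w)"
    using \<open>w \<in> words X\<close>
  proof (induction w)
    case Nil
    then show ?case using assms(2) by simp
  next
    case (Cons a w)
    obtain x b where a: "a = (x, b)" by force
    have "word_value (presented_group X R) (gen X R) w \<in> carrier (presented_group X R)"
      using Cons.prems by (intro word_value_closed[of _ X]) (auto simp: a)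
    then show ?case using Cons assms(3,4) by (auto simp: a)
  qed
  then show ?thesis
    using \<open>w \<in> words X\<close> \<open>A = pres_class X R w\<close> by (simp add: word_value_gen)
qed

text \<open>The uniqueness half of the universal property. It reduces the later identities between
  homomorphisms to a check on generators.\<close>

lemma hom_presented_group_eqI:
  assumes "group G" "h \<in> hom (presented_group X R) G" "h' \<in> hom (presented_group X R) G"
    and "\<And>x. x \<in> X \<Longrightarrow> h (gen X R x) = h' (gen X R x)"
    and "A \<in> carrier (presented_group X R)"
  shows "h A = h' A"
proof -
  interpret h: group_hom "presented_group X R" G h
    using assms by (simp add: group_hom_def group_hom_axioms_def group_presented_group)
  interpret h': group_hom "presented_group X R" G h'
    using assms by (simp add: group_hom_def group_hom_axioms_def group_presented_group)
  show ?thesis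
    using assms(5) by (induction rule: presented_group_induct) (simp_all add: assms(4))
qed

context group_hom
begin

lemma word_value_hom:
  assumes "g \<in> X \<rightarrow> carrier G" "w \<in> words X"
  shows "word_value H (\<lambda>x. h (g x)) w = h (word_value G g w)"
  using assms(2)
proof (induction w)
  case (Cons a w)
  then show ?case using assms(1) by (cases a) (auto simp: Pi_iff G.word_value_closed[OF assms(1)])
qed simp

lemma realizes_hom:
  assumes "realizes G g X R" "R \<subseteq> words X \<times> words X"
  shows "realizes H (\<lambda>x. h (g x)) X R"
proof -
  have g: "g \<in> X \<rightarrow> carrier G" using assms(1) by (simp add: realizes_def)
  have "word_value H (\<lambda>x. h (g x)) r = word_value H (\<lambda>x. h (g x)) s" if "(r, s) \<in> R" for r s
  proof -
    have "r \<in> words X" "s \<in> words X" using that assms(2) by auto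
    then show ?thesis
      using that assms(1) by (auto simp: word_value_hom[OF g] realizes_def)
  qed
  then show ?thesis using g by (auto simp: realizes_def Pi_iff)
qed

end

subsection \<open>Involutions\<close>

context group
begin

lemma pow_mult_swap:
  assumes "a \<in> carrier G" "b \<in> carrier G"
  shows "b \<otimes> (a \<otimes> b) [^] (n::nat) = (b \<otimes> a) [^] n \<otimes> b"
  using assms by (induction n) (simp_all add: m_assoc[symmetric])

lemma pow_mult_eq_one_swap:
  assumes "a \<in> carrier G" "b \<in> carrier G" "(a \<otimes> b) [^] (n::nat) = \<one>"
  shows "(b \<otimes> a) [^] n = \<one>"
  using pow_mult_swap[OF assms(1,2), of n] assms by (simp add: l_cancel_one')

text \<open>For involutions, the inverse of \<open>bab...\<close> is the same word read backwards.
  Appended to \<open>aba...\<close> of length \<open>k\<close> it continues the alternation, which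
  gives an alternating word of length \<open>2k\<close>, that is, \<open>(ab)\<close> to the power
  \<open>k\<close>.\<close>

lemma word_value_alternating:
  assumes "g a \<in> carrier G" "g b \<in> carrier G" "g a \<otimes> g a = \<one>" "g b \<otimes> g b = \<one>"
  shows "word_value G g (alternating a b k) \<in> carrier G"
    and "word_value G g (alternating a b k) \<otimes> inv word_value G g (alternating b a k)
      = (g a \<otimes> g b) [^] k"
proof -
  have c: "word_value G g (alternating a b k) \<in> carrier G"
    if "g a \<in> carrier G" "g b \<in> carrier G" for a b
    using that by (induction k arbitrary: a b) auto
  show "word_value G g (alternating a b k) \<in> carrier G"
    using c assms by blast
  show "word_value G g (alternating a b k) \<otimes> inv word_value G g (alternating b a k)
      = (g a \<otimes> g b) [^] k"
    using assms
  \<comment> \<open>The roles of \<open>a\<close> and \<open>b\<close> alternate: the step splits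
    off \<open>a\<close> on the left and \<open>b\<close> on the right, which leaves the same
    product with the two letters exchanged.\<close>
  proof (induction k arbitrary: a b)
    case (Suc k)
    have cl: "word_value G g (alternating a b k) \<in> carrier G"
        "word_value G g (alternating b a k) \<in> carrier G" for k
      using Suc.prems by (induction k) auto
    have "inv g b = g b" using Suc.prems by (simp add: inv_equality)
    then have "word_value G g (alternating a b (Suc k)) \<otimes> inv word_value G g (alternating b a (Suc k))
      = g a \<otimes> ((word_value G g (alternating b a k) \<otimes> inv word_value G g (alternating a b k)) \<otimes> g b)"
      using Suc.prems cl[of k] by (simp add: inv_mult_group m_assoc)
    also have "\<dots> = g a \<otimes> ((g b \<otimes> g a) [^] k \<otimes> g b)"
      using Suc by simp
    also have "\<dots> = (g a \<otimes> g b) [^] Suc k"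
      using Suc.prems by (simp add: pow_mult_swap[symmetric] nat_pow_Suc2 m_assoc del: nat_pow_Suc Group.nat_pow_Suc)
    finally show ?case .
  qed simp
qed

text \<open>Translates a braid relation between involutions, as in a Dyer presentation, into a
  Coxeter relation.\<close>

lemma alternating_eq_iff:
  assumes "g a \<in> carrier G" "g b \<in> carrier G" "g a \<otimes> g a = \<one>" "g b \<otimes> g b = \<one>"
  shows "word_value G g (alternating a b k) = word_value G g (alternating b a k)
    \<longleftrightarrow> (g a \<otimes> g b) [^] k = \<one>"
proof -
  let ?P = "word_value G g (alternating a b k)" and ?Q = "word_value G g (alternating b a k)"
  have "?P \<in> carrier G" "?Q \<in> carrier G"
    using assms by (simp_all add: word_value_alternating(1))
  then have "?P \<otimes> inv ?Q = \<one> \<longleftrightarrow> ?P = ?Q"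
    using inv_solve_right[of \<one> ?P ?Q] by (metis l_one one_closed)
  then show ?thesis using word_value_alternating(2)[of g a b, OF assms] by simp
qed

lemma word_value_concat_replicate:
  assumes "g a \<in> carrier G" "g b \<in> carrier G"
  shows "word_value G g (concat (replicate n [(a, True), (b, True)])) = (g a \<otimes> g b) [^] n"
proof (induction n)
  case (Suc n)
  then show ?case using assms by (simp add: nat_pow_Suc2 m_assoc del: nat_pow_Suc Group.nat_pow_Suc)
qed simp

lemma word_value_replicate:
  assumes "g a \<in> carrier G"
  shows "word_value G g (replicate n (a, True)) = g a [^] n"
proof (induction n)
  case (Suc n)
  then show ?case using assms by (simp add: nat_pow_Suc2 del: nat_pow_Suc Group.nat_pow_Suc)
qed simp

lemma word_value_alternating_two:
  assumes "g a \<in> carrier G" "g b \<in> carrier G"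
  shows "word_value G g (alternating a b 2) = g a \<otimes> g b"
  using assms by (simp add: numeral_2_eq_2)

lemma pow_two: "a \<in> carrier G \<Longrightarrow> a [^] (2::nat) = a \<otimes> a"
  by (simp add: numeral_2_eq_2)

text \<open>The inverse of \<open>ab\<close> is \<open>ba\<close>, so \<open>ab\<close> is its own
  inverse exactly when the two involutions commute.\<close>

lemma mult_involutions_pow_two_iff:
  assumes "a \<in> carrier G" "b \<in> carrier G" "a \<otimes> a = \<one>" "b \<otimes> b = \<one>"
  shows "(a \<otimes> b) [^] (2::nat) = \<one> \<longleftrightarrow> a \<otimes> b = b \<otimes> a"
proof -
  have "inv (a \<otimes> b) = b \<otimes> a"
    using assms by (simp add: inv_mult_group inv_equality)
  moreover have "(a \<otimes> b) \<otimes> (a \<otimes> b) = \<one> \<longleftrightarrow> inv (a \<otimes> b) = a \<otimes> b"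
    using assms by (metis inv_equality m_closed r_inv)
  ultimately show ?thesis
    using assms by (simp add: pow_two eq_commute)
qed

text \<open>\<open>Y\<close> collects the products of subfamilies of the involutions. Stability
  under left multiplication by each \<open>y i\<close> is the form in which the later decomposition
  of \<open>W\<close> uses it.\<close>

lemma finite_commuting_involutions:
  assumes "finite I" "y \<in> I \<rightarrow> carrier G" "\<And>i. i \<in> I \<Longrightarrow> y i \<otimes> y i = \<one>"
    and "\<And>i j. i \<in> I \<Longrightarrow> j \<in> I \<Longrightarrow> y i \<otimes> y j = y j \<otimes> y i"
  shows "\<exists>Y. finite Y \<and> Y \<subseteq> carrier G \<and> \<one> \<in> Y \<and> (\<forall>i \<in> I. \<forall>a \<in> Y. y i \<otimes> a \<in> Y)"
  using assms
proof (induction I rule: finite_induct)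
  case empty
  show ?case by (intro exI[of _ "{\<one>}"]) simp
next
  case (insert j I)
  then obtain Y where Y: "finite Y" "Y \<subseteq> carrier G" "\<one> \<in> Y" "\<forall>i \<in> I. \<forall>a \<in> Y. y i \<otimes> a \<in> Y"
    by auto
  have yc: "y i \<in> carrier G" if "i \<in> insert j I" for i using insert.prems(1) that by blast
  have 1: "y i \<otimes> (y j \<otimes> a) = y j \<otimes> (y i \<otimes> a)" if "i \<in> I" "a \<in> Y" for i a

  proof -
    have "a \<in> carrier G" "y i \<in> carrier G" "y j \<in> carrier G" using that Y(2) yc by auto
    then show ?thesis using that insert.prems(3)[of i j] by (simp add: m_assoc[symmetric])
  qed
  have 2: "y j \<otimes> (y j \<otimes> a) = a" if "a \<in> Y" for a

  proof -
    have "a \<in> carrier G" "y j \<in> carrier G" using that Y(2) yc by auto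
    then show ?thesis using insert.prems(2)[of j] by (simp add: m_assoc[symmetric])
  qed
  \<comment> \<open>The two halves are \<open>Y\<close> and its translate by \<open>y j\<close>. By
    fact 1 each old \<open>y i\<close> preserves both of them; by fact 2 \<open>y j\<close>
    exchanges them.\<close>
  show ?case
    using Y yc 1 2 by (intro exI[of _ "Y \<union> (\<lambda>a. y j \<otimes> a) ` Y"]) auto
qed

end

subsection \<open>Dyer relations and Coxeter relations in an arbitrary group\<close>

context group
begin

lemma commute_mult:
  assumes "a \<in> carrier G" "b \<in> carrier G" "c \<in> carrier G"
    and "a \<otimes> b = b \<otimes> a" "a \<otimes> c = c \<otimes> a"
  shows "a \<otimes> (b \<otimes> c) = (b \<otimes> c) \<otimes> a"
proof -
  have "a \<otimes> (b \<otimes> c) = b \<otimes> (a \<otimes> c)"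
    using assms(1-3) by (simp add: m_assoc[symmetric] assms(4))
  then show ?thesis
    using assms(1-3) by (simp add: m_assoc assms(5))
qed

lemma commute_inv:
  assumes "a \<in> carrier G" "b \<in> carrier G" "a \<otimes> b = b \<otimes> a"
  shows "inv a \<otimes> b = b \<otimes> inv a"
proof -
  have "inv a \<otimes> b = inv a \<otimes> (b \<otimes> a) \<otimes> inv a"
    using assms(1,2) by (simp add: m_assoc)
  also have "\<dots> = b \<otimes> inv a"
    using assms(1,2) unfolding assms(3)[symmetric] by (simp add: m_assoc[symmetric])
  finally show ?thesis .
qed

end

lemma alternating_words [simp]: "a \<in> X \<Longrightarrow> b \<in> X \<Longrightarrow> alternating a b k \<in> words X"
  by (induction k arbitrary: a b) simp_all

lemma replicate_words [simp]: "a \<in> X \<Longrightarrow> replicate n (a, c) \<in> words X"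
  by (induction n) simp_all

lemma concat_replicate_words [simp]: "w \<in> words X \<Longrightarrow> concat (replicate n w) \<in> words X"
  by (induction n) simp_all

lemma coxeter_relations_words: "coxeter_relations S M \<subseteq> words S \<times> words S"
  by (auto simp: coxeter_relations_def)

lemma Ball_coxeter_relations:
  "(\<forall>(r, s) \<in> coxeter_relations S M. P r s) \<longleftrightarrow>
    (\<forall>s \<in> S. \<forall>t \<in> S. \<forall>n. M s t = enat n \<longrightarrow> P (concat (replicate n [(s, True), (t, True)])) [])"
  unfolding coxeter_relations_def by fast

lemma Ball_dyer_relations:
  "(\<forall>(r, s) \<in> dyer_relations V E f m. P r s) \<longleftrightarrow>
    (\<forall>v \<in> V. \<forall>n. f v = enat n \<longrightarrow> P (replicate n (v, True)) []) \<and>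
    (\<forall>u v. {u, v} \<in> E \<longrightarrow> P (alternating v u (m {u, v})) (alternating u v (m {u, v})))"
  unfolding dyer_relations_def ball_Un by (intro arg_cong2[of _ _ _ _ "(\<and>)"]) auto

lemma (in group) realizes_coxeter_iff:
  "realizes G z S (coxeter_relations S M) \<longleftrightarrow>
    z \<in> S \<rightarrow> carrier G \<and>
    (\<forall>s \<in> S. \<forall>t \<in> S. \<forall>n. M s t = enat n \<longrightarrow> (z s \<otimes> z t) [^] n = \<one>)"
proof (cases "z \<in> S \<rightarrow> carrier G")
  case True
  then have "word_value G z (concat (replicate n [(s, True), (t, True)])) = (z s \<otimes> z t) [^] n"
    if "s \<in> S" "t \<in> S" for s t n
    using that by (intro word_value_concat_replicate) auto
  then show ?thesis
    using True by (simp add: realizes_def Ball_coxeter_relations)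
qed (simp add: realizes_def)

section \<open>Dyer relations as power, commutation and Coxeter relations\<close>

context dyer_graph
begin

text \<open>The last clause is the dichotomy behind the later case distinctions: an endpoint with
  \<open>f\<close> at least 3 forces the label 2, so any larger label joins two vertices of order
  2.\<close>

lemma edgeD:
  assumes "{u, v} \<in> E"
  shows "u \<in> V" "v \<in> V" "u \<noteq> v" "m {u, v} = 2 \<or> f u = 2 \<and> f v = 2"
proof -
  show V: "u \<in> V" "v \<in> V" using edges[OF assms] by auto
  show "u \<noteq> v" using edges[OF assms] by auto
  have *: "f w \<ge> 3 \<or> f w = 2" if "w \<in> V" for w
    using f_ge_2[OF that] by (cases "f w") (auto simp: numeral_eq_enat)
  show "m {u, v} = 2 \<or> f u = 2 \<and> f v = 2"
    using *[OF V(1)] *[OF V(2)] m_eq_2[OF assms, of u] m_eq_2[OF assms, of v] by auto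
qed

lemma dyer_relations_words: "dyer_relations V E f m \<subseteq> words V \<times> words V"
  using edgeD(1,2) by (auto simp: dyer_relations_def)

text \<open>By \<open>edgeD\<close> an edge relation is either a commutation or a braid relation
  between involutions, and the latter is a Coxeter relation by \<open>alternating_eq_iff\<close>.
  For label 2 between vertices of order 2 both clauses apply, and they agree.\<close>

lemma realizes_dyer_iff:
  fixes G (structure)
  assumes "group G"
  shows "realizes G x V (dyer_relations V E f m) \<longleftrightarrow>
    x \<in> V \<rightarrow> carrier G \<and>
    (\<forall>v \<in> V. \<forall>n. f v = enat n \<longrightarrow> x v [^]\<^bsub>G\<^esub> n = \<one>\<^bsub>G\<^esub>) \<and>
    (\<forall>u v. {u, v} \<in> E \<longrightarrow> m {u, v} = 2 \<longrightarrow> x u \<otimes>\<^bsub>G\<^esub> x v = x v \<otimes>\<^bsub>G\<^esub> x u) \<and>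
    (\<forall>u v. {u, v} \<in> E \<longrightarrow> f u = 2 \<longrightarrow> f v = 2 \<longrightarrow>
      (x u \<otimes>\<^bsub>G\<^esub> x v) [^]\<^bsub>G\<^esub> m {u, v} = \<one>\<^bsub>G\<^esub>)"
    (is "_ \<longleftrightarrow> ?c \<and> ?p \<and> ?comm \<and> ?cox")
proof -
  interpret group G by fact
  have "realizes G x V (dyer_relations V E f m) \<longleftrightarrow> ?c \<and> ?p \<and>
    (\<forall>u v. {u, v} \<in> E \<longrightarrow>
      word_value G x (alternating v u (m {u, v})) = word_value G x (alternating u v (m {u, v})))"
    (is "_ \<longleftrightarrow> _ \<and> _ \<and> ?alt")
  proof (cases ?c)
    case True
    then have "word_value G x (replicate n (v, True)) = x v [^] n" if "v \<in> V" for v n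
      using that by (intro word_value_replicate) auto
    moreover have "(\<forall>(r, s) \<in> dyer_relations V E f m. word_value G x r = word_value G x s) \<longleftrightarrow>
      (\<forall>v \<in> V. \<forall>n. f v = enat n \<longrightarrow> word_value G x (replicate n (v, True)) = \<one>) \<and> ?alt"
      by (simp add: Ball_dyer_relations)
    ultimately show ?thesis
      using True by (simp add: realizes_def)
  qed (simp add: realizes_def)
  \<comment> \<open>The power relations enter here because they make the elements at vertices with
    \<open>f u = 2\<close> involutions.\<close>
  moreover have "?alt \<longleftrightarrow> ?comm \<and> ?cox" if ?c ?p
  proof -
    have "word_value G x (alternating v u (m {u, v})) = word_value G x (alternating u v (m {u, v}))
      \<longleftrightarrow> (m {u, v} = 2 \<longrightarrow> x u \<otimes> x v = x v \<otimes> x u) \<and>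
        (f u = 2 \<longrightarrow> f v = 2 \<longrightarrow> (x u \<otimes> x v) [^] m {u, v} = \<one>)"
      if "{u, v} \<in> E" for u v
    proof -
      have c: "x u \<in> carrier G" "x v \<in> carrier G" using \<open>?c\<close> edgeD[OF that] by auto
      have sq: "x w \<otimes> x w = \<one>" if "w \<in> V" "f w = 2" for w
      proof -
        have "x w [^] (2::nat) = \<one>" "x w \<in> carrier G"
          using \<open>?p\<close> \<open>?c\<close> that by (auto simp: numeral_eq_enat)
        then show ?thesis by (simp add: pow_two)
      qed
      show ?thesis
      proof (cases "f u = 2 \<and> f v = 2")
        case True
        then have "x u \<otimes> x u = \<one>" "x v \<otimes> x v = \<one>" using sq edgeD[OF that] by auto
        then show ?thesis
          using True alternating_eq_iff[of x u v "m {u, v}"]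
            mult_involutions_pow_two_iff[of "x u" "x v"] c by auto
      next
        case False
        then have "m {u, v} = 2" using edgeD[OF that] by auto
        then show ?thesis using False c by (auto simp: word_value_alternating_two)
      qed
    qed
    then show ?thesis by blast
  qed
  ultimately show ?thesis by blast
qed

lemma dyer_square:
  assumes "group G" "realizes G x V (dyer_relations V E f m)" "v \<in> V" "f v = 2"
  shows "x v \<otimes>\<^bsub>G\<^esub> x v = \<one>\<^bsub>G\<^esub>"
proof -
  interpret group G by fact
  have "x v [^]\<^bsub>G\<^esub> (2::nat) = \<one>\<^bsub>G\<^esub>" "x v \<in> carrier G"
    using assms realizes_dyer_iff[OF assms(1), of x] by (auto simp: numeral_eq_enat)
  then show ?thesis by (simp add: pow_two)
qed

text \<open>Power and commutation relations survive inverting one element, and the remaining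
  relations involve only involutions, which equal their inverses. This produces the endomorphism of
  \<open>D\<close> by which \<open>y\<^sub>w\<close> acts.\<close>

lemma realizes_dyer_invert:
  fixes G (structure)
  assumes "group G" "realizes G x V (dyer_relations V E f m)"
  shows "realizes G (\<lambda>u. if u = w then inv\<^bsub>G\<^esub> x u else x u) V (dyer_relations V E f m)"
    (is "realizes G ?x V _")
proof -
  interpret group G by fact
  note iff = realizes_dyer_iff[OF \<open>group G\<close>]
  have x: "x u \<in> carrier G" if "u \<in> V" for u
    using assms(2) that by (auto simp: iff)
  have eq: "?x u = x u" if "u \<in> V" "f u = 2" for u
    using dyer_square[OF assms that] x[OF that(1)] by (auto simp: inv_equality)
  have "?x u \<otimes> ?x v = ?x v \<otimes> ?x u" if uv: "{u, v} \<in> E" "m {u, v} = 2" for u v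
  proof -
    have "x u \<otimes> x v = x v \<otimes> x u" using assms(2) uv unfolding iff by blast
    then show ?thesis
      using x[OF edgeD(1)[OF uv(1)]] x[OF edgeD(2)[OF uv(1)]]
        commute_inv[of "x u" "x v"] commute_inv[of "x v" "x u"] by auto
  qed
  moreover have "(?x u \<otimes> ?x v) [^] m {u, v} = \<one>" if "{u, v} \<in> E" "f u = 2" "f v = 2" for u v
    using that edgeD[OF that(1)] eq assms(2) by (simp add: iff)
  moreover have "?x v [^] n = \<one>" if "v \<in> V" "f v = enat n" for v n
    using that x assms(2) by (auto simp: iff nat_pow_inv)
  moreover have "?x \<in> V \<rightarrow> carrier G"
    using x by auto
  ultimately show ?thesis
    unfolding iff by blast
qed

end

subsection \<open>The Coxeter group of a Dyer graph\<close>

text \<open>The natural index set of the Coxeter generators consists of pairs of a vertex and a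
  Boolean. The injection \<open>code\<close> carries them into an arbitrary type, finally into the
  natural numbers.\<close>

locale coded_dyer_graph = dyer_graph V E f m
  for V :: "'v set" and E :: "'v set set" and f :: "'v \<Rightarrow> enat" and m :: "'v set \<Rightarrow> nat" +
  fixes code :: "'v \<times> bool \<Rightarrow> 's"
  assumes inj_code: "inj_on code (V \<times> UNIV)"
begin

text \<open>\<open>code (v, True)\<close> is the generator \<open>y\<^sub>v\<close> and \<open>code (v, False)\<close> is \<open>s\<^sub>v\<close>.\<close>

definition reflections :: "'s set"
  where "reflections = code ` (V \<times> UNIV)"

definition decode :: "'s \<Rightarrow> 'v \<times> bool"
  where "decode = inv_into (V \<times> UNIV) code"

text \<open>The orders are those in the semidirect product: \<open>s\<^sub>v y\<^sub>v\<close> is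
  \<open>x\<^sub>v\<close> if \<open>f v \<noteq> 2\<close>, and for \<open>f v = 2\<close> the two
  generators commute; \<open>y\<^sub>v\<close> commutes with everything at other vertices. Non-edges
  get \<infinity>, hence no relation.\<close>

definition cox :: "'s \<Rightarrow> 's \<Rightarrow> enat"
  where "cox s t = (case (decode s, decode t) of ((u, a), (v, b)) \<Rightarrow>
    if u = v then if a = b then 1 else f v
    else if a \<or> b then 2
    else if {u, v} \<in> E then enat (m {u, v}) else \<infinity>)"

definition cox_family :: "('a, 'b) monoid_scheme \<Rightarrow> ('v \<Rightarrow> 'a) \<Rightarrow> ('v \<Rightarrow> 'a) \<Rightarrow> 's \<Rightarrow> 'a"
  where "cox_family G x y s = (case decode s of (v, b) \<Rightarrow>
    if b then y v else if f v = 2 then x v else x v \<otimes>\<^bsub>G\<^esub> y v)"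

text \<open>Inverts the translation in \<open>cox_family\<close>: since \<open>y\<^sub>v\<close> is
  an involution, \<open>s\<^sub>v = x\<^sub>v y\<^sub>v\<close> gives
  \<open>x\<^sub>v = s\<^sub>v y\<^sub>v\<close>.\<close>

definition dyer_family :: "('a, 'b) monoid_scheme \<Rightarrow> ('s \<Rightarrow> 'a) \<Rightarrow> 'v \<Rightarrow> 'a"
  where "dyer_family G z v =
    (if f v = 2 then z (code (v, False)) else z (code (v, False)) \<otimes>\<^bsub>G\<^esub> z (code (v, True)))"

lemma decode_code [simp]: "v \<in> V \<Longrightarrow> decode (code (v, b)) = (v, b)"
  by (simp add: decode_def inv_into_f_f[OF inj_code])

lemma code_reflections [simp]: "v \<in> V \<Longrightarrow> code (v, b) \<in> reflections"
  by (simp add: reflections_def)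

lemma reflections_cases [consumes 1]:
  assumes "s \<in> reflections"
  obtains v b where "s = code (v, b)" "v \<in> V"
  using assms by (auto simp: reflections_def)

lemma coxeter_matrix_cox: "coxeter_matrix reflections cox"
proof
  fix s assume "s \<in> reflections"
  then show "cox s s = 1" by (auto elim!: reflections_cases simp: cox_def)
next
  fix s t assume "s \<in> reflections" "t \<in> reflections" "s \<noteq> t"
  then show "cox s t \<ge> 2"
    using f_ge_2 m_ge_2 by (auto elim!: reflections_cases simp: cox_def numeral_eq_enat)
next
  fix s t assume "s \<in> reflections" "t \<in> reflections"
  then show "cox s t = cox t s"
    by (auto elim!: reflections_cases simp: cox_def insert_commute)
qed

text \<open>The hypotheses on \<open>x\<close> and \<open>y\<close> are the defining relations of
  the semidirect product; the Coxeter relations are derived from them one kind of matrix entry at a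
  time.\<close>

lemma realizes_cox_family:
  fixes G (structure)
  assumes "group G" "realizes G x V (dyer_relations V E f m)"
    and y: "\<And>v. v \<in> V \<Longrightarrow> y v \<in> carrier G"
    and y_square: "\<And>v. v \<in> V \<Longrightarrow> y v \<otimes>\<^bsub>G\<^esub> y v = \<one>\<^bsub>G\<^esub>"
    and y_comm: "\<And>u v. u \<in> V \<Longrightarrow> v \<in> V \<Longrightarrow> y u \<otimes>\<^bsub>G\<^esub> y v = y v \<otimes>\<^bsub>G\<^esub> y u"
    and y_x: "\<And>u v. u \<in> V \<Longrightarrow> v \<in> V \<Longrightarrow>
      y v \<otimes>\<^bsub>G\<^esub> x u = (if u = v then inv\<^bsub>G\<^esub> x u else x u) \<otimes>\<^bsub>G\<^esub> y v"
  shows "realizes G (cox_family G x y) reflections (coxeter_relations reflections cox)"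
proof -
  interpret group G by fact
  note iff = realizes_dyer_iff[OF \<open>group G\<close>]
  define s where "s v = (if f v = 2 then x v else x v \<otimes> y v)" for v
  have x: "x v \<in> carrier G" if "v \<in> V" for v using assms(2) that by (auto simp: iff)
  have s: "s v \<in> carrier G" if "v \<in> V" for v using x y that by (simp add: s_def)
  have s_square: "s v \<otimes> s v = \<one>" if "v \<in> V" for v
  proof -
    \<comment> \<open>Moving the inner \<open>y v\<close> past \<open>x v\<close> inverts
      \<open>x v\<close>, so everything cancels.\<close>
    have "(x v \<otimes> y v) \<otimes> (x v \<otimes> y v) = x v \<otimes> (y v \<otimes> x v) \<otimes> y v"
      using x y that by (simp add: m_assoc)
    also have "\<dots> = \<one>"
      using x y that by (simp add: y_x y_square m_assoc)
    finally show ?thesis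
      using that dyer_square[OF assms(1,2) that] by (simp add: s_def)
  qed
  have s_y: "s u \<otimes> y v = y v \<otimes> s u" if "u \<in> V" "v \<in> V" "u \<noteq> v" for u v
  proof -
    have "y v \<otimes> x u = x u \<otimes> y v" using that y_x[of u v] by simp
    then show ?thesis
      using commute_mult[OF y[OF that(2)] x[OF that(1)] y[OF that(1)] _ y_comm[OF that(2,1)]]
      by (simp add: s_def)
  qed
  have s_y_pow: "(s v \<otimes> y v) [^] n = \<one>" if "v \<in> V" "f v = enat n" for v n
  proof (cases "f v = 2")
    case True
    then have "n = 2" using that by (simp add: numeral_eq_enat)
    have "inv x v = x v" using dyer_square[OF assms(1,2) that(1) True] x[OF that(1)]
      by (simp add: inv_equality)
    then have "x v \<otimes> y v = y v \<otimes> x v" using y_x[of v v] that by simp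
    then show ?thesis
      using True \<open>n = 2\<close> that x y y_square s_square[OF that(1)]
      by (simp add: s_def mult_involutions_pow_two_iff)
  next
    case False
    have "s v \<otimes> y v = x v" using False that x y y_square by (simp add: s_def m_assoc)
    then show ?thesis using assms(2) that by (simp add: iff)
  qed
  have s_s: "s u \<otimes> s v = s v \<otimes> s u" if "{u, v} \<in> E" "m {u, v} = 2" for u v
  proof -
    have V: "u \<in> V" "v \<in> V" "u \<noteq> v" using edgeD[OF that(1)] by auto
    have xx: "x u \<otimes> x v = x v \<otimes> x u" using assms(2) that unfolding iff by blast
    have xy: "x u \<otimes> y v = y v \<otimes> x u" using y_x[of u v] V by simp
    have "x u \<otimes> s v = s v \<otimes> x u"
      using xx commute_mult[OF x[OF V(1)] x[OF V(2)] y[OF V(2)] xx xy] by (simp add: s_def)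
    moreover have "s v \<otimes> y u = y u \<otimes> s v" using s_y[of v u] V by simp
    ultimately show ?thesis
      using commute_mult[OF s[OF V(2)] x[OF V(1)] y[OF V(1)]] by (simp add: s_def[of u])
  qed
  \<comment> \<open>Label 2 is commutation. Any other label forces \<open>f u = f v = 2\<close>,
    where \<open>s\<close> coincides with \<open>x\<close> and the Dyer relation applies
    directly.\<close>
  have s_s_pow: "(s u \<otimes> s v) [^] m {u, v} = \<one>" if "{u, v} \<in> E" for u v
  proof (cases "m {u, v} = 2")
    case True
    then show ?thesis
      using s_s[OF that] edgeD[OF that] s s_square by (simp add: mult_involutions_pow_two_iff)
  next
    case False
    then show ?thesis
      using edgeD(4)[OF that] assms(2) that by (simp add: iff s_def)
  qed
  have val: "cox_family G x y (code (v, b)) = (if b then y v else s v)" if "v \<in> V" for v b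
    using that by (simp add: cox_family_def s_def)
  have "(cox_family G x y r \<otimes> cox_family G x y t) [^] n = \<one>"
    if r: "r \<in> reflections" and t: "t \<in> reflections" and n: "cox r t = enat n" for r t n
  proof -
    obtain u a where u: "r = code (u, a)" "u \<in> V" using r by (rule reflections_cases)
    obtain v b where v: "t = code (v, b)" "v \<in> V" using t by (rule reflections_cases)
    let ?g = "\<lambda>v b. if b then y v else s v"
    have inv: "?g w c \<in> carrier G" "?g w c \<otimes> ?g w c = \<one>" if "w \<in> V" for w c
      using that y s y_square s_square by auto
    \<comment> \<open>These cases exhaust the finite entries of the matrix; two generators
      \<open>s\<close> at distinct non-adjacent vertices are excluded because their entry is
      \<infinity>.\<close>
    consider (same) "u = v" "a = b" | (dihedral) "u = v" "a \<noteq> b" | (comm) "u \<noteq> v" "a \<or> b"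
      | (edge) "u \<noteq> v" "\<not> a" "\<not> b" "{u, v} \<in> E"
      using n u v by (fastforce simp: cox_def split: if_splits)
    then have "(?g u a \<otimes> ?g v b) [^] n = \<one>"
    proof cases
      case same
      then show ?thesis using inv[OF u(2), of a] by auto
    next
      case dihedral
      then have "f v = enat n" using n u v by (simp add: cox_def)
      then show ?thesis
        using dihedral v s_y_pow[of v n] pow_mult_eq_one_swap[of "s v" "y v" n] s y by auto
    next
      case comm
      then have "n = 2" using n u v by (auto simp: cox_def numeral_eq_enat)
      have "?g u a \<otimes> ?g v b = ?g v b \<otimes> ?g u a"
        using comm u v s_y[of u v] s_y[of v u] y_comm[of u v] by auto
      then show ?thesis
        using mult_involutions_pow_two_iff[of "?g u a" "?g v b"] inv u v \<open>n = 2\<close> by blast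
    next
      case edge
      then show ?thesis using n u v s_s_pow[OF edge(4)] by (simp add: cox_def)
    qed
    then show ?thesis using u v by (simp add: val)
  qed
  moreover have "cox_family G x y \<in> reflections \<rightarrow> carrier G"
    using s y by (auto elim!: reflections_cases simp: val)
  ultimately show ?thesis by (auto simp: realizes_coxeter_iff)
qed

section \<open>Dyer relations in a group satisfying the Coxeter relations\<close>

context
  fixes G :: "('a, 'b) monoid_scheme" and z
  assumes G: "group G"
    and z: "realizes G z reflections (coxeter_relations reflections cox)"
begin

interpretation group G by (rule G)

lemma cox_closed: "v \<in> V \<Longrightarrow> z (code (v, b)) \<in> carrier G"
  using z by (auto simp: realizes_coxeter_iff)

lemma cox_pow:
  assumes "u \<in> V" "v \<in> V" "cox (code (u, a)) (code (v, b)) = enat n"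
  shows "(z (code (u, a)) \<otimes>\<^bsub>G\<^esub> z (code (v, b))) [^]\<^bsub>G\<^esub> n = \<one>\<^bsub>G\<^esub>"
  using assms z by (auto simp: realizes_coxeter_iff)

lemma cox_square:
  assumes "v \<in> V"
  shows "z (code (v, b)) \<otimes>\<^bsub>G\<^esub> z (code (v, b)) = \<one>\<^bsub>G\<^esub>"
  using cox_pow[of v v b b 1] cox_closed assms by (simp add: cox_def one_enat_def)

lemma cox_commute:
  assumes "u \<in> V" "v \<in> V" "cox (code (u, a)) (code (v, b)) = 2"
  shows "z (code (u, a)) \<otimes>\<^bsub>G\<^esub> z (code (v, b)) = z (code (v, b)) \<otimes>\<^bsub>G\<^esub> z (code (u, a))"
  using cox_pow[OF assms(1,2), of a b 2] assms cox_closed cox_square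
  by (simp add: numeral_eq_enat mult_involutions_pow_two_iff)

lemma cox_commute_True:
  assumes "u \<in> V" "v \<in> V" "u \<noteq> v \<or> b"
  shows "z (code (v, True)) \<otimes>\<^bsub>G\<^esub> z (code (u, b)) = z (code (u, b)) \<otimes>\<^bsub>G\<^esub> z (code (v, True))"
  using assms cox_commute[of v u True b] by (cases "u = v") (auto simp: cox_def)

lemma dyer_family_closed: "v \<in> V \<Longrightarrow> dyer_family G z v \<in> carrier G"
  using cox_closed by (simp add: dyer_family_def)

text \<open>If \<open>f v \<noteq> 2\<close>, the power relation at \<open>v\<close> is the Coxeter
  relation of \<open>s\<^sub>v\<close> and \<open>y\<^sub>v\<close>. Across an edge with label 2,
  both generators at one end commute with both at the other. Between vertices of order 2 the family
  consists of the \<open>s\<^sub>v\<close> themselves.\<close>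

lemma realizes_dyer_family: "realizes G (dyer_family G z) V (dyer_relations V E f m)"
proof -
  have "dyer_family G z v [^]\<^bsub>G\<^esub> n = \<one>\<^bsub>G\<^esub>" if "v \<in> V" "f v = enat n" for v n
  proof (cases "f v = 2")
    case True
    then have "n = 2" using that by (simp add: numeral_eq_enat)
    then show ?thesis
      using True that cox_square[of v False] cox_closed by (simp add: dyer_family_def pow_two)
  next
    case False
    then show ?thesis
      using that cox_pow[of v v False True n] by (simp add: dyer_family_def cox_def)
  qed
  moreover have "dyer_family G z u \<otimes>\<^bsub>G\<^esub> dyer_family G z v
      = dyer_family G z v \<otimes>\<^bsub>G\<^esub> dyer_family G z u"
    if "{u, v} \<in> E" "m {u, v} = 2" for u v
  proof -
    have V: "u \<in> V" "v \<in> V" "u \<noteq> v" using edgeD[OF that(1)] by auto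
    have c: "z (code (u, a)) \<otimes>\<^bsub>G\<^esub> z (code (v, b)) = z (code (v, b)) \<otimes>\<^bsub>G\<^esub> z (code (u, a))" for a b
      using that V by (intro cox_commute) (auto simp: cox_def numeral_eq_enat)
    have "z (code (u, a)) \<otimes>\<^bsub>G\<^esub> dyer_family G z v = dyer_family G z v \<otimes>\<^bsub>G\<^esub> z (code (u, a))" for a
      using c commute_mult[OF cox_closed[OF V(1)] cox_closed[OF V(2)] cox_closed[OF V(2)] c c]
      by (simp add: dyer_family_def)
    then show ?thesis
      using commute_mult[OF dyer_family_closed[OF V(2)] cox_closed[OF V(1)] cox_closed[OF V(1)]]
      by (simp add: dyer_family_def[of G z u])
  qed
  moreover have "(dyer_family G z u \<otimes>\<^bsub>G\<^esub> dyer_family G z v) [^]\<^bsub>G\<^esub> m {u, v} = \<one>\<^bsub>G\<^esub>"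
    if "{u, v} \<in> E" "f u = 2" "f v = 2" for u v
    using that edgeD[OF that(1)] cox_pow[of u v False False] by (simp add: dyer_family_def cox_def)
  ultimately show ?thesis
    using dyer_family_closed unfolding realizes_dyer_iff[OF G] by blast
qed

text \<open>Away from \<open>v\<close>, the involution \<open>y\<^sub>v\<close> commutes with both
  factors. At \<open>v\<close> with \<open>f v = 2\<close> it commutes with the involution
  \<open>s\<^sub>v\<close>; otherwise conjugation turns \<open>s\<^sub>v y\<^sub>v\<close> into
  \<open>y\<^sub>v s\<^sub>v\<close>, its inverse.\<close>

lemma dyer_family_conj:
  assumes "u \<in> V" "v \<in> V"
  shows "z (code (v, True)) \<otimes>\<^bsub>G\<^esub> dyer_family G z u \<otimes>\<^bsub>G\<^esub> z (code (v, True))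
    = (if u = v then inv\<^bsub>G\<^esub> dyer_family G z u else dyer_family G z u)"
proof -
  let ?y = "z (code (v, True))" and ?s = "z (code (u, False))"
  have c: "?y \<in> carrier G" "?s \<in> carrier G" "dyer_family G z u \<in> carrier G"
    using assms cox_closed dyer_family_closed by auto
  have y: "?y \<otimes>\<^bsub>G\<^esub> ?y = \<one>\<^bsub>G\<^esub>" and s: "?s \<otimes>\<^bsub>G\<^esub> ?s = \<one>\<^bsub>G\<^esub>"
    using assms cox_square by auto
  have comm: "?y \<otimes>\<^bsub>G\<^esub> dyer_family G z u \<otimes>\<^bsub>G\<^esub> ?y = dyer_family G z u"
    if "?y \<otimes>\<^bsub>G\<^esub> dyer_family G z u = dyer_family G z u \<otimes>\<^bsub>G\<^esub> ?y"
    using that c y by (simp add: m_assoc)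
  consider "u \<noteq> v" | "u = v" "f v = 2" | "u = v" "f v \<noteq> 2" by blast
  then show ?thesis
  proof cases
    case 1
    then have ys: "?y \<otimes>\<^bsub>G\<^esub> z (code (u, b)) = z (code (u, b)) \<otimes>\<^bsub>G\<^esub> ?y" for b
      using cox_commute_True assms by blast
    have "?y \<otimes>\<^bsub>G\<^esub> dyer_family G z u = dyer_family G z u \<otimes>\<^bsub>G\<^esub> ?y"
      using ys commute_mult[OF c(1) cox_closed[OF assms(1)] cox_closed[OF assms(1)] ys ys]
      by (simp add: dyer_family_def)
    then show ?thesis using 1 comm by simp
  next
    case 2
    then have "?y \<otimes>\<^bsub>G\<^esub> ?s = ?s \<otimes>\<^bsub>G\<^esub> ?y"
      using assms cox_commute[of v v True False] by (simp add: cox_def)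
    then show ?thesis
      using 2 comm c s by (simp add: dyer_family_def inv_equality)
  next
    case 3
    have "?y \<otimes>\<^bsub>G\<^esub> (?s \<otimes>\<^bsub>G\<^esub> ?y) \<otimes>\<^bsub>G\<^esub> ?y = ?y \<otimes>\<^bsub>G\<^esub> ?s"
      using c y by (simp add: m_assoc)
    also have "\<dots> = inv\<^bsub>G\<^esub> (?s \<otimes>\<^bsub>G\<^esub> ?y)"
      using c y s by (simp add: inv_mult_group inv_equality)
    finally show ?thesis using 3 by (simp add: dyer_family_def)
  qed
qed

end

end

subsection \<open>The Dyer group acts on itself\<close>

lemma (in group) left_mult_Bij:
  assumes "a \<in> carrier G"
  shows "(\<lambda>b \<in> carrier G. a \<otimes> b) \<in> Bij (carrier G)"
proof -
  have "bij_betw (\<lambda>b. a \<otimes> b) (carrier G) (carrier G)"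
    using assms by (intro bij_betw_byWitness[of _ "\<lambda>b. inv a \<otimes> b"])
      (auto simp: m_assoc[symmetric])
  then show ?thesis by (simp add: Bij_def cong: bij_betw_cong)
qed

lemma BijGroup_mult:
  assumes "g \<in> Bij S" "h \<in> Bij S"
  shows "g \<otimes>\<^bsub>BijGroup S\<^esub> h = (\<lambda>a \<in> S. g (h a))"
  using assms by (simp add: BijGroup_def compose_def)

text \<open>Cayley's left regular representation; the restriction to the carrier makes the maps
  extensional, as \<open>Bij\<close> demands.\<close>

lemma (in group) left_mult_hom:
  "(\<lambda>a. \<lambda>b \<in> carrier G. a \<otimes> b) \<in> hom G (BijGroup (carrier G))"
proof (rule homI)
  fix a b assume "a \<in> carrier G" "b \<in> carrier G"
  then show "(\<lambda>c \<in> carrier G. a \<otimes> b \<otimes> c) =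
      (\<lambda>c \<in> carrier G. a \<otimes> c) \<otimes>\<^bsub>BijGroup (carrier G)\<^esub> (\<lambda>c \<in> carrier G. b \<otimes> c)"
    by (simp add: BijGroup_mult left_mult_Bij m_assoc cong: restrict_cong)
qed (simp add: left_mult_Bij BijGroup_def)

context coded_dyer_graph
begin

abbreviation "D \<equiv> dyer_group V E f m"
abbreviation "W \<equiv> coxeter_group reflections cox"
abbreviation "dyer_gen \<equiv> gen V (dyer_relations V E f m)"
abbreviation "cox_gen \<equiv> gen reflections (coxeter_relations reflections cox)"

lemma group_D: "group D" and group_W: "group W"
  by (simp_all add: dyer_group_def coxeter_group_def group_presented_group)

lemma realizes_dyer_gen: "realizes D dyer_gen V (dyer_relations V E f m)"
  unfolding dyer_group_def by (rule realizes_gen[OF dyer_relations_words])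

lemma realizes_cox_gen: "realizes W cox_gen reflections (coxeter_relations reflections cox)"
  unfolding coxeter_group_def by (rule realizes_gen[OF coxeter_relations_words])

lemma dyer_gen_closed: "v \<in> V \<Longrightarrow> dyer_gen v \<in> carrier D"
  by (simp add: dyer_group_def)

lemma dyer_hom_ex:
  assumes "group G" "realizes G x V (dyer_relations V E f m)"
  shows "\<exists>h \<in> hom D G. \<forall>v \<in> V. h (dyer_gen v) = x v"
  using group.realizes_imp_hom[OF assms] by (simp add: dyer_group_def)

lemma dyer_hom_eqI:
  assumes "group G" "h \<in> hom D G" "h' \<in> hom D G"
    and "\<And>v. v \<in> V \<Longrightarrow> h (dyer_gen v) = h' (dyer_gen v)" "a \<in> carrier D"
  shows "h a = h' a"
  using hom_presented_group_eqI[OF assms(1), of h V _ h'] assms(2-) by (simp add: dyer_group_def)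

lemma invert_hom_ex:
  "\<exists>\<sigma>. \<forall>w. \<sigma> w \<in> hom D D \<and>
    (\<forall>u \<in> V. \<sigma> w (dyer_gen u) = (if u = w then inv\<^bsub>D\<^esub> dyer_gen u else dyer_gen u))"
  using dyer_hom_ex[OF group_D realizes_dyer_invert[OF group_D realizes_dyer_gen]]
  by (intro choice) blast

text \<open>Left multiplications and the automorphisms \<sigma> satisfy the relations of the
  semidirect product inside the permutations of \<open>D\<close>, so
  \<open>realizes_cox_family\<close> yields an action of \<open>W\<close>. It serves to show that
  \<open>D\<close> embeds.\<close>

lemma cox_action_ex:
  "\<exists>\<rho> \<in> hom W (BijGroup (carrier D)). \<forall>v \<in> V.
    \<rho> (dyer_family W cox_gen v) = (\<lambda>a \<in> carrier D. dyer_gen v \<otimes>\<^bsub>D\<^esub> a)"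
proof -
  let ?B = "BijGroup (carrier D)"
  define L where "L a = (\<lambda>b \<in> carrier D. a \<otimes>\<^bsub>D\<^esub> b)" for a
  interpret D: group D by (rule group_D)
  interpret B: group ?B by (rule group_BijGroup)
  interpret L: group_hom D ?B L
    using D.left_mult_hom by unfold_locales (simp add: L_def[abs_def])
  obtain \<sigma> where \<sigma>: "\<And>w. \<sigma> w \<in> hom D D"
    "\<And>u w. u \<in> V \<Longrightarrow> \<sigma> w (dyer_gen u) = (if u = w then inv\<^bsub>D\<^esub> dyer_gen u else dyer_gen u)"
    using invert_hom_ex by blast
  interpret \<sigma>: group_hom D D "\<sigma> w" for w
    using \<sigma>(1) by unfold_locales
  have \<sigma>_compose: "(\<lambda>a. \<sigma> w (\<sigma> w' a)) \<in> hom D D" for w w'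
    using hom_compose[OF \<sigma>(1)[of w'] \<sigma>(1)[of w]] by (simp add: o_def)
  \<comment> \<open>Both sides are homomorphisms, and on a generator \<sigma> either inverts twice
    or does nothing.\<close>
  have \<sigma>\<sigma>: "\<sigma> w (\<sigma> w a) = a" if "a \<in> carrier D" for w a
  proof (rule dyer_hom_eqI[OF group_D \<sigma>_compose _ _ that])
    show "(\<lambda>a. a) \<in> hom D D" by (simp add: hom_def)
    show "\<sigma> w (\<sigma> w (dyer_gen v)) = dyer_gen v" if "v \<in> V" for v
      using that dyer_gen_closed by (auto simp: \<sigma>(2))
  qed
  have \<sigma>_comm: "\<sigma> w (\<sigma> w' a) = \<sigma> w' (\<sigma> w a)" if "a \<in> carrier D" for w w' a
  proof (rule dyer_hom_eqI[OF group_D \<sigma>_compose \<sigma>_compose _ that])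
    show "\<sigma> w (\<sigma> w' (dyer_gen v)) = \<sigma> w' (\<sigma> w (dyer_gen v))" if "v \<in> V" for v
      using that dyer_gen_closed by (auto simp: \<sigma>(2))
  qed
  define y where "y w = restrict (\<sigma> w) (carrier D)" for w
  have y_Bij: "y w \<in> Bij (carrier D)" for w
  proof -
    have "bij_betw (\<sigma> w) (carrier D) (carrier D)"
      using \<sigma>\<sigma> by (intro bij_betw_byWitness[of _ "\<sigma> w"]) auto
    then show ?thesis by (simp add: y_def Bij_def cong: bij_betw_cong)
  qed
  then have y_closed: "y w \<in> carrier ?B" for w by (simp add: BijGroup_def)
  have L_Bij: "L a \<in> Bij (carrier D)" if "a \<in> carrier D" for a
    using D.left_mult_Bij[OF that] by (simp add: L_def)
  have y_square: "y w \<otimes>\<^bsub>?B\<^esub> y w = \<one>\<^bsub>?B\<^esub>" for w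
  proof -
    have "y w \<otimes>\<^bsub>?B\<^esub> y w = (\<lambda>a \<in> carrier D. a)"
      unfolding BijGroup_mult[OF y_Bij y_Bij] by (rule restrict_ext) (simp add: y_def \<sigma>\<sigma>)
    then show ?thesis by (simp add: BijGroup_def)
  qed
  have y_comm: "y w \<otimes>\<^bsub>?B\<^esub> y w' = y w' \<otimes>\<^bsub>?B\<^esub> y w" for w w'
    unfolding BijGroup_mult[OF y_Bij y_Bij] by (rule restrict_ext) (simp add: y_def \<sigma>_comm)
  \<comment> \<open>Multiplicativity of \<open>\<sigma> w\<close>, read as an identity between
    permutations. On generators it becomes the relation between \<open>y\<close> and
    \<open>x\<close> required by \<open>realizes_cox_family\<close>.\<close>
  have "y w \<otimes>\<^bsub>?B\<^esub> L a = L (\<sigma> w a) \<otimes>\<^bsub>?B\<^esub> y w" if "a \<in> carrier D" for w a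
    using that unfolding BijGroup_mult[OF y_Bij L_Bij[OF that]]
      BijGroup_mult[OF L_Bij[OF \<sigma>.hom_closed[OF that]] y_Bij]
    by (intro restrict_ext) (simp add: y_def L_def)
  then have y_L: "y w \<otimes>\<^bsub>?B\<^esub> L (dyer_gen u) =
      (if u = w then inv\<^bsub>?B\<^esub> L (dyer_gen u) else L (dyer_gen u)) \<otimes>\<^bsub>?B\<^esub> y w" if "u \<in> V" for u w
    using that \<sigma>(2) dyer_gen_closed by auto
  let ?z = "cox_family ?B (\<lambda>v. L (dyer_gen v)) y"
  have "realizes ?B ?z reflections (coxeter_relations reflections cox)"
    using L.realizes_hom[OF realizes_dyer_gen dyer_relations_words] y_closed y_square y_comm y_L
    by (intro realizes_cox_family) (auto simp: group_BijGroup)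
  then obtain \<rho> where \<rho>: "\<rho> \<in> hom W ?B" "\<And>s. s \<in> reflections \<Longrightarrow> \<rho> (cox_gen s) = ?z s"
    using B.realizes_imp_hom unfolding coxeter_group_def by blast
  \<comment> \<open>If \<open>f v \<noteq> 2\<close>, the image is \<open>L (dyer_gen v)\<close>
    times \<open>y v\<close> twice, and the involution cancels.\<close>
  have "\<rho> (dyer_family W cox_gen v) = L (dyer_gen v)" if "v \<in> V" for v
  proof -
    have "L (dyer_gen v) \<in> carrier ?B" using that dyer_gen_closed by simp
    moreover have "cox_gen (code (v, b)) \<in> carrier W" for b
      using that by (simp add: coxeter_group_def)
    ultimately show ?thesis
      using that y_closed[of v] y_square[of v] \<rho>(2) hom_mult[OF \<rho>(1)]
      by (simp add: dyer_family_def cox_family_def B.m_assoc)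
  qed
  then show ?thesis using \<rho>(1) by (auto simp: L_def)
qed

section \<open>Finite index of the image of the Dyer group\<close>

text \<open>The set of products of \<open>?H\<close> and \<open>Y\<close> contains the identity and
  is stable under left multiplication by Coxeter generators, so it is all of \<open>W\<close>. Hence
  every right coset of \<open>?H\<close> has a representative in the finite set
  \<open>Y\<close>.\<close>

lemma finite_index_image:
  assumes "finite V" and \<phi>: "\<phi> \<in> hom D W"
    and \<phi>_gen: "\<And>v. v \<in> V \<Longrightarrow> \<phi> (dyer_gen v) = dyer_family W cox_gen v"
  shows "finite (rcosets\<^bsub>W\<^esub> (\<phi> ` carrier D))"
proof -
  interpret D: group D by (rule group_D)
  interpret W: group W by (rule group_W)
  interpret \<phi>: group_hom D W \<phi> using \<phi> by unfold_locales
  let ?H = "\<phi> ` carrier D"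
  define y where "y v = cox_gen (code (v, True))" for v
  define s where "s v = cox_gen (code (v, False))" for v
  note cox = group_W realizes_cox_gen
  have y: "y v \<in> carrier W" "y v \<otimes>\<^bsub>W\<^esub> y v = \<one>\<^bsub>W\<^esub>" and s: "s v \<in> carrier W"
    if "v \<in> V" for v
    using cox_closed[OF cox] cox_square[OF cox] that by (auto simp: y_def s_def)
  have y_comm: "y u \<otimes>\<^bsub>W\<^esub> y v = y v \<otimes>\<^bsub>W\<^esub> y u" if "u \<in> V" "v \<in> V" for u v
    unfolding y_def by (rule cox_commute_True[OF cox that(2,1)]) simp
  obtain Y where Y: "finite Y" "Y \<subseteq> carrier W" "\<one>\<^bsub>W\<^esub> \<in> Y" "\<forall>v \<in> V. \<forall>a \<in> Y. y v \<otimes>\<^bsub>W\<^esub> a \<in> Y"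
    using W.finite_commuting_involutions[OF assms(1) funcsetI[of V y, OF y(1)] y(2) y_comm] by blast
  obtain \<sigma> where \<sigma>: "\<And>w. \<sigma> w \<in> hom D D"
    "\<And>u w. u \<in> V \<Longrightarrow> \<sigma> w (dyer_gen u) = (if u = w then inv\<^bsub>D\<^esub> dyer_gen u else dyer_gen u)"
    using invert_hom_ex by blast
  interpret \<sigma>: group_hom D D "\<sigma> w" for w
    using \<sigma>(1) by unfold_locales
  \<comment> \<open>Both sides are homomorphisms in \<open>a\<close>, so
    \<open>dyer_family_conj\<close> on the generators suffices. This is the normalisation of
    \<open>?H\<close> by the \<open>y v\<close>.\<close>
  have conj: "y v \<otimes>\<^bsub>W\<^esub> \<phi> a \<otimes>\<^bsub>W\<^esub> y v = \<phi> (\<sigma> v a)" if "v \<in> V" "a \<in> carrier D" for v a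
  proof (rule dyer_hom_eqI[OF group_W _ _ _ that(2)])
    show "(\<lambda>a. y v \<otimes>\<^bsub>W\<^esub> \<phi> a \<otimes>\<^bsub>W\<^esub> y v) \<in> hom D W"
    proof (rule homI)
      fix a b assume ab: "a \<in> carrier D" "b \<in> carrier D"
      have "y v \<otimes>\<^bsub>W\<^esub> (y v \<otimes>\<^bsub>W\<^esub> c) = c" if "c \<in> carrier W" for c
        using that y[OF \<open>v \<in> V\<close>] by (simp add: W.m_assoc[symmetric])
      then show "y v \<otimes>\<^bsub>W\<^esub> \<phi> (a \<otimes>\<^bsub>D\<^esub> b) \<otimes>\<^bsub>W\<^esub> y v =
          (y v \<otimes>\<^bsub>W\<^esub> \<phi> a \<otimes>\<^bsub>W\<^esub> y v) \<otimes>\<^bsub>W\<^esub> (y v \<otimes>\<^bsub>W\<^esub> \<phi> b \<otimes>\<^bsub>W\<^esub> y v)"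
        using ab y[OF that(1)] by (simp add: W.m_assoc)
    qed (use y that in simp)
    show "(\<lambda>a. \<phi> (\<sigma> v a)) \<in> hom D W"
      by (auto simp: hom_def)
    show "y v \<otimes>\<^bsub>W\<^esub> \<phi> (dyer_gen u) \<otimes>\<^bsub>W\<^esub> y v = \<phi> (\<sigma> v (dyer_gen u))" if "u \<in> V" for u
      using dyer_family_conj[OF cox that \<open>v \<in> V\<close>] that dyer_gen_closed
      by (auto simp: \<phi>_gen \<sigma>(2) y_def)
  qed
  have y_step: "\<exists>h' \<in> ?H. \<exists>c' \<in> Y. y v \<otimes>\<^bsub>W\<^esub> (h \<otimes>\<^bsub>W\<^esub> c) = h' \<otimes>\<^bsub>W\<^esub> c'"
    if v: "v \<in> V" and "h \<in> ?H" and c: "c \<in> Y" for v h c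
  proof -
    obtain a where a: "h = \<phi> a" "a \<in> carrier D" using \<open>h \<in> ?H\<close> by blast
    have "c \<in> carrier W" using c Y(2) by blast
    \<comment> \<open>Inserting \<open>y v\<close> twice moves it past \<open>\<phi> a\<close>: the
      conjugate stays in \<open>?H\<close>, and the remaining \<open>y v\<close> is absorbed into
      \<open>Y\<close>.\<close>
    then have "(y v \<otimes>\<^bsub>W\<^esub> \<phi> a \<otimes>\<^bsub>W\<^esub> y v) \<otimes>\<^bsub>W\<^esub> (y v \<otimes>\<^bsub>W\<^esub> c)
        = y v \<otimes>\<^bsub>W\<^esub> \<phi> a \<otimes>\<^bsub>W\<^esub> (y v \<otimes>\<^bsub>W\<^esub> y v) \<otimes>\<^bsub>W\<^esub> c"
      using a y(1)[OF v] by (simp add: W.m_assoc del: y(2))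
    then have "y v \<otimes>\<^bsub>W\<^esub> (h \<otimes>\<^bsub>W\<^esub> c) = \<phi> (\<sigma> v a) \<otimes>\<^bsub>W\<^esub> (y v \<otimes>\<^bsub>W\<^esub> c)"
      using a y[OF v] \<open>c \<in> carrier W\<close> conj[OF v a(2)] by (simp add: W.m_assoc)
    moreover have "\<phi> (\<sigma> v a) \<in> ?H" "y v \<otimes>\<^bsub>W\<^esub> c \<in> Y" using a Y(4) v c by auto
    ultimately show ?thesis by blast
  qed
  have x_step: "\<exists>h' \<in> ?H. \<exists>c' \<in> Y. \<phi> (dyer_gen v) \<otimes>\<^bsub>W\<^esub> (h \<otimes>\<^bsub>W\<^esub> c) = h' \<otimes>\<^bsub>W\<^esub> c'"
    if v: "v \<in> V" and h: "h \<in> ?H" and c: "c \<in> Y" for v h c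
  proof -
    obtain a where a: "h = \<phi> a" "a \<in> carrier D" using h by blast
    have "c \<in> carrier W" using c Y(2) by blast
    then have "\<phi> (dyer_gen v) \<otimes>\<^bsub>W\<^esub> (h \<otimes>\<^bsub>W\<^esub> c) = \<phi> (dyer_gen v \<otimes>\<^bsub>D\<^esub> a) \<otimes>\<^bsub>W\<^esub> c"
      using a v dyer_gen_closed by (simp add: W.m_assoc)
    then show ?thesis using a v c dyer_gen_closed by blast
  qed
  have step: "\<exists>h' \<in> ?H. \<exists>c' \<in> Y. cox_gen r \<otimes>\<^bsub>W\<^esub> (h \<otimes>\<^bsub>W\<^esub> c) = h' \<otimes>\<^bsub>W\<^esub> c'"
    if r: "r \<in> reflections" and h: "h \<in> ?H" and c: "c \<in> Y" for r h c
  proof -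
    obtain v b where v: "r = code (v, b)" "v \<in> V" using r by (rule reflections_cases)
    consider b | "\<not> b" "f v = 2" | "\<not> b" "f v \<noteq> 2" by blast
    then show ?thesis
    proof cases
      case 1
      then show ?thesis using y_step[OF v(2) h c] v by (simp add: y_def)
    next
      case 2
      then show ?thesis using x_step[OF v(2) h c] v by (simp add: \<phi>_gen dyer_family_def)
    next
      case 3
      obtain h' c' where h': "h' \<in> ?H" "c' \<in> Y" "y v \<otimes>\<^bsub>W\<^esub> (h \<otimes>\<^bsub>W\<^esub> c) = h' \<otimes>\<^bsub>W\<^esub> c'"
        using y_step[OF v(2) h c] by blast
      have hc: "h \<otimes>\<^bsub>W\<^esub> c \<in> carrier W" using h c Y(2) by auto
      \<comment> \<open>Here \<open>s v\<close> is a product of two elements already treated, so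
        \<open>y_step\<close> is followed by \<open>x_step\<close>.\<close>
      have "s v = \<phi> (dyer_gen v) \<otimes>\<^bsub>W\<^esub> y v"
        using 3 v y[OF v(2)] s[OF v(2)]
        by (simp add: \<phi>_gen dyer_family_def s_def y_def W.m_assoc)
      then have "cox_gen r \<otimes>\<^bsub>W\<^esub> (h \<otimes>\<^bsub>W\<^esub> c) = \<phi> (dyer_gen v) \<otimes>\<^bsub>W\<^esub> (h' \<otimes>\<^bsub>W\<^esub> c')"
        using 3 v hc y[OF v(2)] dyer_gen_closed h'(3)[symmetric] by (simp add: s_def W.m_assoc)
      then show ?thesis using x_step[OF v(2) h'(1,2)] by simp
    qed
  qed
  \<comment> \<open>Coxeter generators are involutions, so the inverse case of the induction below
    is the generator case again.\<close>
  have cox_gen_inv: "inv\<^bsub>W\<^esub> cox_gen r = cox_gen r" if r: "r \<in> reflections" for r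
  proof -
    obtain v b where v: "r = code (v, b)" "v \<in> V" using r by (rule reflections_cases)
    show ?thesis
      using W.inv_equality[OF cox_square[OF cox v(2)] cox_closed[OF cox v(2)] cox_closed[OF cox v(2)]]
      by (simp add: v(1))
  qed
  have decomp: "\<exists>h \<in> ?H. \<exists>c \<in> Y. w = h \<otimes>\<^bsub>W\<^esub> c" if "w \<in> carrier W" for w
    using that[unfolded coxeter_group_def]
  proof (induction rule: presented_group_induct)
    case one
    have "\<one>\<^bsub>W\<^esub> = \<one>\<^bsub>W\<^esub> \<otimes>\<^bsub>W\<^esub> \<one>\<^bsub>W\<^esub>" "\<one>\<^bsub>W\<^esub> \<in> ?H"
      using \<phi>.hom_one D.one_closed by (simp, metis imageI)
    then show ?case using Y(3) unfolding coxeter_group_def by blast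
  next
    case (gen r w)
    then show ?case using step unfolding coxeter_group_def by blast
  next
    case (inv_gen r w)
    then show ?case using step cox_gen_inv unfolding coxeter_group_def by metis
  qed
  have H: "?H \<subseteq> carrier W" "subgroup ?H W" using \<phi>.img_is_subgroup by auto
  have "rcosets\<^bsub>W\<^esub> ?H \<subseteq> (\<lambda>c. ?H #>\<^bsub>W\<^esub> c) ` Y"
  proof
    fix C assume "C \<in> rcosets\<^bsub>W\<^esub> ?H"
    then obtain w where w: "w \<in> carrier W" "C = ?H #>\<^bsub>W\<^esub> w" by (auto simp: RCOSETS_def)
    obtain h c where hc: "h \<in> ?H" "c \<in> Y" "w = h \<otimes>\<^bsub>W\<^esub> c" using decomp[OF w(1)] by blast
    have c: "c \<in> carrier W" using hc(2) Y(2) by blast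
    have "w \<in> ?H #>\<^bsub>W\<^esub> c" using hc by (auto simp: r_coset_def)
    then have "C = ?H #>\<^bsub>W\<^esub> c" using W.repr_independence[OF _ c H(2)] w by simp
    then show "C \<in> (\<lambda>c. ?H #>\<^bsub>W\<^esub> c) ` Y" using hc(2) by blast
  qed
  then show ?thesis using Y(1) finite_subset by blast
qed

section \<open>Injectivity and conclusion\<close>

theorem dyer_group_finite_index:
  assumes "finite V"
  shows "\<exists>H. subgroup H W \<and> finite (rcosets\<^bsub>W\<^esub> H) \<and> D \<cong> W\<lparr>carrier := H\<rparr>"
proof -
  interpret D: group D by (rule group_D)
  interpret W: group W by (rule group_W)
  obtain \<phi> where \<phi>: "\<phi> \<in> hom D W" "\<And>v. v \<in> V \<Longrightarrow> \<phi> (dyer_gen v) = dyer_family W cox_gen v"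
    using dyer_hom_ex[OF group_W realizes_dyer_family[OF group_W realizes_cox_gen]] by blast
  obtain \<rho> where \<rho>: "\<rho> \<in> hom W (BijGroup (carrier D))"
    "\<And>v. v \<in> V \<Longrightarrow> \<rho> (dyer_family W cox_gen v) = (\<lambda>a \<in> carrier D. dyer_gen v \<otimes>\<^bsub>D\<^esub> a)"
    using cox_action_ex by blast
  interpret \<phi>: group_hom D W \<phi> using \<phi>(1) by unfold_locales
  \<comment> \<open>The composite agrees with the left regular representation on generators, hence
    everywhere.\<close>
  have \<rho>\<phi>: "\<rho> (\<phi> a) = (\<lambda>b \<in> carrier D. a \<otimes>\<^bsub>D\<^esub> b)" if "a \<in> carrier D" for a
  proof (rule dyer_hom_eqI[OF group_BijGroup _ D.left_mult_hom _ that])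
    show "(\<lambda>a. \<rho> (\<phi> a)) \<in> hom D (BijGroup (carrier D))"
      using hom_compose[OF \<phi>(1) \<rho>(1)] by (simp add: o_def)
    show "\<rho> (\<phi> (dyer_gen v)) = (\<lambda>b \<in> carrier D. dyer_gen v \<otimes>\<^bsub>D\<^esub> b)" if "v \<in> V" for v
      by (simp only: \<phi>(2)[OF that] \<rho>(2)[OF that])
  qed
  have "inj_on \<phi> (carrier D)"
  proof (rule inj_onI)
    fix a b assume ab: "a \<in> carrier D" "b \<in> carrier D" "\<phi> a = \<phi> b"
    \<comment> \<open>Evaluating both left multiplications at the identity recovers \<open>a\<close>
      and \<open>b\<close>, so the faithful action of \<open>D\<close> forces \<phi> to be
      injective.\<close>
    then have "(\<lambda>c \<in> carrier D. a \<otimes>\<^bsub>D\<^esub> c) \<one>\<^bsub>D\<^esub> = (\<lambda>c \<in> carrier D. b \<otimes>\<^bsub>D\<^esub> c) \<one>\<^bsub>D\<^esub>"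
      by (simp only: \<rho>\<phi>[symmetric])
    then show "a = b" using ab by simp
  qed
  then have "\<phi> \<in> iso D (W\<lparr>carrier := \<phi> ` carrier D\<rparr>)"
    by (auto simp: iso_def hom_def bij_betw_def)
  then show ?thesis
    using \<phi>.img_is_subgroup finite_index_image[OF assms \<phi>] is_isoI by blast
qed

end

theorem corollary1p2:
  fixes V :: "'v set" and E :: "'v set set" and f :: "'v \<Rightarrow> enat" and m :: "'v set \<Rightarrow> nat"
  assumes "dyer_graph V E f m" and "finite V"
  shows "\<exists>(S :: nat set) M H. coxeter_matrix S M \<and>
           subgroup H (coxeter_group S M) \<and>
           finite (rcosets\<^bsub>coxeter_group S M\<^esub> H) \<and>
           dyer_group V E f m \<cong> (coxeter_group S M)\<lparr>carrier := H\<rparr>"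
proof -
  have "finite (V \<times> (UNIV :: bool set))" using assms(2) by simp
  \<comment> \<open>Finiteness of \<open>V\<close> makes room for the Coxeter generators among the
    natural numbers; any injection serves.\<close>
  then obtain code :: "'v \<times> bool \<Rightarrow> nat" where "inj_on code (V \<times> UNIV)"
    using finite_imp_inj_to_nat_seg[OF \<open>finite (V \<times> UNIV)\<close>] by blast
  then interpret coded_dyer_graph V E f m code
    using assms(1) by (simp add: coded_dyer_graph_def coded_dyer_graph_axioms_def)
  show ?thesis
    using coxeter_matrix_cox dyer_group_finite_index[OF assms(2)] by blast
qed

end
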